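(* Let $G$ and $H$ be groups. Then $G$ and $H$ are isomorphic (as groups) if and only if their superextensions $\lambda(G)$ and $\lambda(H)$ are isomorphic (as semigroups).
   Context: A family $\mathcal A$ of non-empty subsets of a set $X$ is an upfamily if $A\in\mathcal A$ and $A\subset B\subset X$ imply $B\in\mathcal A$. A family $\mathcal B$ of non-empty subsets of $X$ generates the upfamily $\langle \mathcal B\rangle=\{A\subset X:\exists B\in\mathcal B\ (B\subset A)\}$; we write $\langle B: B\in\mathcal B\rangle$ for it. An upfamily $\mathcal L$ is linked if $A\cap B\neq\emptyset$ for all $A,B\in\mathcal L$. The superextension $\lambda(X)$ is the set of all maximal (with respect to inclusion) linked upfamilies on $X$. For a semigroup $S$ (in particular, a group) with operation $*$, the set $\lambda(S)$ is a semigroup under the (known to be well-defined and associative) operation $$\mathcal A*\mathcal B=\Big\langle\bigcup_{a\in A}a*B_a : A\in\mathcal A,\ \{B_a\}_{a\in A}\subset\mathcal B\Big\rangle .$$ A semigroup isomorphism is a bijection preserving the operation. The groups are arbitrary (not necessarily finite). *)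

theory Defs
  imports "HOL-Algebra.Coset"
begin

definition upfamily :: "'a set \<Rightarrow> 'a set set \<Rightarrow> bool" where
  "upfamily X F \<longleftrightarrow>
     F \<subseteq> Pow X \<and> {} \<notin> F \<and> (\<forall>A\<in>F. \<forall>B. A \<subseteq> B \<and> B \<subseteq> X \<longrightarrow> B \<in> F)"

definition generated_upfamily :: "'a set \<Rightarrow> 'a set set \<Rightarrow> 'a set set" where
  "generated_upfamily X F = {A. A \<subseteq> X \<and> (\<exists>B\<in>F. B \<subseteq> A)}"

definition linked_upfamily :: "'a set \<Rightarrow> 'a set set \<Rightarrow> bool" where
  "linked_upfamily X L \<longleftrightarrow> upfamily X L \<and> (\<forall>A\<in>L. \<forall>B\<in>L. A \<inter> B \<noteq> {})"

definition superextension :: "'a set \<Rightarrow> 'a set set set" where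
  "superextension X =
     {L. linked_upfamily X L \<and> (\<forall>M. linked_upfamily X M \<and> L \<subseteq> M \<longrightarrow> M = L)}"

text \<open>
  The selection \<open>{B\<^sub>a}\<close> is a function \<open>f\<close>, relevant only on \<open>A\<close>; the left
  translate \<open>a * B\<close> is written with the library's left-coset operator, whose definition
  makes sense for an arbitrary set \<open>B\<close>.
\<close>

definition superextension_mult ::
    "('a, 'm) monoid_scheme \<Rightarrow> 'a set set \<Rightarrow> 'a set set \<Rightarrow> 'a set set" where
  "superextension_mult S \<A> \<B> =
     generated_upfamily (carrier S)
       {\<Union>a\<in>A. a <#\<^bsub>S\<^esub> f a | A f. A \<in> \<A> \<and> f \<in> A \<rightarrow> \<B>}"

text \<open>
  The record type requires a unit, for which we take the principal ultrafilter at the unit of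
  \<open>S\<close>. It plays no role in \<open>hom\<close>, \<open>iso\<close> and \<open>\<cong>\<close>, which refer to
  carriers and multiplications only; so \<open>\<cong>\<close> between these records is isomorphism
  of semigroups.
\<close>

definition superextension_semigroup :: "('a, 'm) monoid_scheme \<Rightarrow> 'a set set monoid" where
  "superextension_semigroup S =
     \<lparr>carrier = superextension (carrier S),
      mult = superextension_mult S,
      one = {A. A \<subseteq> carrier S \<and> \<one>\<^bsub>S\<^esub> \<in> A}\<rparr>"

end

theory Submission
  imports Defs
begin

text \<open>
  The principal ultrafilter at the unit is the identity of the superextension, and the invertible
  elements are exactly the principal ultrafilters: if \<open>\<A> * \<B>\<close> contains the singleton of
  the unit, then a member of \<open>\<A>\<close> consists of elements \<open>a\<close> whose inverses form
  singletons in \<open>\<B>\<close>; as \<open>\<B>\<close> is linked, there is only one such \<open>a\<close>.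
  Hence a group is recovered as the group of units of its superextension.
\<close>

section \<open>Maximal linked upfamilies and principal ultrafilters\<close>

definition principal :: "'a set \<Rightarrow> 'a \<Rightarrow> 'a set set" where
  "principal X a = {A. A \<subseteq> X \<and> a \<in> A}"

text \<open>The usual image of an ultrafilter, with membership tested on preimages. Preimages
  respect inclusions and intersections, so upward closure and linkedness carry over for any map;
  bijectivity matters only for maximality.\<close>

definition pushforward :: "('a \<Rightarrow> 'b) \<Rightarrow> 'a set \<Rightarrow> 'b set \<Rightarrow> 'a set set \<Rightarrow> 'b set set" where
  "pushforward f X Y L = {D. D \<subseteq> Y \<and> {x \<in> X. f x \<in> D} \<in> L}"

lemma upfamily_mono: "upfamily X L \<Longrightarrow> A \<in> L \<Longrightarrow> A \<subseteq> B \<Longrightarrow> B \<subseteq> X \<Longrightarrow> B \<in> L"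
  unfolding upfamily_def by blast

lemma superextension_upfamily: "L \<in> superextension X \<Longrightarrow> upfamily X L"
  by (simp add: superextension_def linked_upfamily_def)

lemma superextension_linked:
  "L \<in> superextension X \<Longrightarrow> A \<in> L \<Longrightarrow> B \<in> L \<Longrightarrow> A \<inter> B \<noteq> {}"
  by (simp add: superextension_def linked_upfamily_def)

lemma superextension_subset: "L \<in> superextension X \<Longrightarrow> A \<in> L \<Longrightarrow> A \<subseteq> X"
  using superextension_upfamily unfolding upfamily_def by blast

text \<open>Reduces maximality to a test on single sets: a member \<open>C\<close> of a linked
  extension \<open>M\<close> meets every member of \<open>L\<close>, since these lie in
  \<open>M\<close> too, and the second premise then puts \<open>C\<close> back into
  \<open>L\<close>.\<close>

lemma superextensionI:
  assumes "linked_upfamily X L"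
    and "\<And>C. C \<subseteq> X \<Longrightarrow> (\<And>A. A \<in> L \<Longrightarrow> A \<inter> C \<noteq> {}) \<Longrightarrow> C \<in> L"
  shows "L \<in> superextension X"
proof -
  have "M = L" if M: "linked_upfamily X M" and "L \<subseteq> M" for M
  proof
    show "M \<subseteq> L"
    proof
      fix C assume C: "C \<in> M"
      show "C \<in> L"
      proof (rule assms(2))
        show "C \<subseteq> X"
          using M C by (auto simp: linked_upfamily_def upfamily_def)
        show "A \<inter> C \<noteq> {}" if "A \<in> L" for A
          using that M C \<open>L \<subseteq> M\<close> by (auto simp: linked_upfamily_def)
      qed
    qed
  qed fact
  then show ?thesis
    using assms(1) by (auto simp: superextension_def)
qed

text \<open>Converse of the criterion in \<open>superextensionI\<close>: adjoining \<open>C\<close>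
  and its supersets to \<open>L\<close> keeps the family linked, so by maximality they were there
  already. For empty \<open>X\<close> this fails: the empty family is then maximal, and the empty
  set meets all its members vacuously.\<close>

lemma superextension_meets:
  assumes L: "L \<in> superextension X" and "X \<noteq> {}" and C: "C \<subseteq> X"
    and meets: "\<And>A. A \<in> L \<Longrightarrow> A \<inter> C \<noteq> {}"
  shows "C \<in> L"
proof (cases "C = {}")
  \<comment> \<open>No set meets the empty set, so \<open>meets\<close> leaves only
    \<open>L = {}\<close>, which \<open>{X}\<close> properly extends; the case is
    contradictory.\<close>
  case True
  then have "L = {}"
    using meets by blast
  moreover have "linked_upfamily X {X}"
    using \<open>X \<noteq> {}\<close> by (auto simp: linked_upfamily_def upfamily_def)
  ultimately show ?thesis
    using L by (auto simp: superextension_def)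
next
  case False
  let ?M = "L \<union> {B. C \<subseteq> B \<and> B \<subseteq> X}"
  have up: "upfamily X L"
    using L by (rule superextension_upfamily)
  have "upfamily X ?M"
    using up False unfolding upfamily_def by blast
  moreover have "A \<inter> B \<noteq> {}" if "A \<in> ?M" "B \<in> ?M" for A B
    using that meets superextension_linked[OF L] False by blast
  ultimately have "linked_upfamily X ?M"
    by (simp add: linked_upfamily_def)
  then have "?M = L"
    using L by (auto simp: superextension_def)
  then show ?thesis
    using C by blast
qed

lemma principal_in_superextension:
  assumes "a \<in> X"
  shows "principal X a \<in> superextension X"
proof (rule superextensionI)
  show "linked_upfamily X (principal X a)"
    by (auto simp: linked_upfamily_def upfamily_def principal_def)
next
  fix C assume "C \<subseteq> X" and meets: "\<And>A. A \<in> principal X a \<Longrightarrow> A \<inter> C \<noteq> {}"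
  moreover have "{a} \<in> principal X a"
    using assms by (simp add: principal_def)
  ultimately show "C \<in> principal X a"
    using meets[of "{a}"] by (auto simp: principal_def)
qed

lemma principal_eq_iff:
  assumes "a \<in> X" "b \<in> X"
  shows "principal X a = principal X b \<longleftrightarrow> a = b"
proof
  assume "principal X a = principal X b"
  moreover have "{a} \<in> principal X a"
    using assms by (simp add: principal_def)
  ultimately show "a = b"
    by (auto simp: principal_def)
qed simp

text \<open>Linkedness with \<open>{a}\<close> forces \<open>a\<close> into every member; upward
  closure from \<open>{a}\<close> gives the other inclusion.\<close>

lemma superextension_eq_principal:
  assumes L: "L \<in> superextension X" and a: "{a} \<in> L"
  shows "L = principal X a"
proof
  show "L \<subseteq> principal X a"
    using superextension_linked[OF L a] superextension_subset[OF L] by (auto simp: principal_def)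
  show "principal X a \<subseteq> L"
    using upfamily_mono[OF superextension_upfamily[OF L] a] by (auto simp: principal_def)
qed

section \<open>Transport along bijections\<close>

lemma pushforward_in_superextension:
  assumes f: "bij_betw f X Y" and "X \<noteq> {}" and L: "L \<in> superextension X"
  shows "pushforward f X Y L \<in> superextension Y"
proof (rule superextensionI)
  have up: "upfamily X L"
    using L by (rule superextension_upfamily)
  have "upfamily Y (pushforward f X Y L)"
    unfolding upfamily_def
  proof (intro conjI ballI allI impI)
    show "pushforward f X Y L \<subseteq> Pow Y"
      by (auto simp: pushforward_def)
    show "{} \<notin> pushforward f X Y L"
      using up by (auto simp: pushforward_def upfamily_def)
    fix A B assume A: "A \<in> pushforward f X Y L" and B: "A \<subseteq> B \<and> B \<subseteq> Y"
    have "{x \<in> X. f x \<in> B} \<in> L"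
      by (rule upfamily_mono[OF up, of "{x \<in> X. f x \<in> A}"]) (use A B in \<open>auto simp: pushforward_def\<close>)
    then show "B \<in> pushforward f X Y L"
      using B by (simp add: pushforward_def)
  qed
  moreover have "A \<inter> B \<noteq> {}" if "A \<in> pushforward f X Y L" "B \<in> pushforward f X Y L" for A B
    using superextension_linked[OF L, of "{x \<in> X. f x \<in> A}" "{x \<in> X. f x \<in> B}"] that
    by (auto simp: pushforward_def)
  ultimately show "linked_upfamily Y (pushforward f X Y L)"
    by (simp add: linked_upfamily_def)
next
  fix C assume C: "C \<subseteq> Y" and meets: "\<And>A. A \<in> pushforward f X Y L \<Longrightarrow> A \<inter> C \<noteq> {}"
  have "{x \<in> X. f x \<in> C} \<in> L"
  proof (rule superextension_meets[OF L \<open>X \<noteq> {}\<close>])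
    fix A assume A: "A \<in> L"
    then have AX: "A \<subseteq> X"
      by (rule superextension_subset[OF L])
    have "{x \<in> X. f x \<in> f ` A} = A"
      using f AX by (auto simp: bij_betw_def inj_on_def)
    then have "f ` A \<in> pushforward f X Y L"
      using A AX f by (auto simp: pushforward_def bij_betw_def)
    then have "f ` A \<inter> C \<noteq> {}"
      by (rule meets)
    then show "A \<inter> {x \<in> X. f x \<in> C} \<noteq> {}"
      using AX by blast
  qed auto
  then show "C \<in> pushforward f X Y L"
    using C by (simp add: pushforward_def)
qed

text \<open>Iterated preimages are preimages under the composite, which is the identity on
  \<open>X\<close>.\<close>

lemma pushforward_inverse:
  assumes g: "g \<in> Y \<rightarrow> X" and f: "f \<in> X \<rightarrow> Y" and gf: "\<And>x. x \<in> X \<Longrightarrow> g (f x) = x"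
    and L: "L \<in> superextension X"
  shows "pushforward g Y X (pushforward f X Y L) = L"
proof -
  have "{x \<in> X. f x \<in> {y \<in> Y. g y \<in> D}} = D" if "D \<subseteq> X" for D
    using that f gf by auto
  then show ?thesis
    using superextension_subset[OF L] by (auto simp: pushforward_def)
qed

lemma bij_betw_pushforward:
  assumes f: "bij_betw f X Y" and X: "X \<noteq> {}"
  shows "bij_betw (pushforward f X Y) (superextension X) (superextension Y)"
proof (rule bij_betw_byWitness[where f' = "pushforward (inv_into X f) Y X"])
  let ?g = "inv_into X f"
  have g: "bij_betw ?g Y X"
    using f by (rule bij_betw_inv_into)
  have Y: "Y \<noteq> {}"
    using f X by (auto simp: bij_betw_def)
  have fg_in: "f \<in> X \<rightarrow> Y" "?g \<in> Y \<rightarrow> X"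
    using f g by (auto dest: bij_betwE)
  show "\<forall>L\<in>superextension X. pushforward ?g Y X (pushforward f X Y L) = L"
    using pushforward_inverse[OF fg_in(2,1)] bij_betw_inv_into_left[OF f] by blast
  show "\<forall>L\<in>superextension Y. pushforward f X Y (pushforward ?g Y X L) = L"
    using pushforward_inverse[OF fg_in] bij_betw_inv_into_right[OF f] by blast
  show "pushforward f X Y ` superextension X \<subseteq> superextension Y"
    using pushforward_in_superextension[OF f X] by blast
  show "pushforward ?g Y X ` superextension Y \<subseteq> superextension X"
    using pushforward_in_superextension[OF g Y] by blast
qed

section \<open>Membership in a product\<close>

lemma superextension_multI:
  assumes "A \<in> \<A>" "f \<in> A \<rightarrow> \<B>" "(\<Union>a\<in>A. a <#\<^bsub>S\<^esub> f a) \<subseteq> C" "C \<subseteq> carrier S"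
  shows "C \<in> superextension_mult S \<A> \<B>"
proof -
  have *: "(\<Union>a\<in>A. a <#\<^bsub>S\<^esub> f a) \<in> {\<Union>a\<in>A. a <#\<^bsub>S\<^esub> f a | A f. A \<in> \<A> \<and> f \<in> A \<rightarrow> \<B>}"
    by (intro CollectI exI[of _ A] exI[of _ f] conjI refl assms)
  then show ?thesis
    unfolding superextension_mult_def generated_upfamily_def
    using assms(3,4) by (intro CollectI conjI bexI[OF _ *])
qed

text \<open>Removes the selection: for a given \<open>C\<close> there is a largest admissible choice
  at each \<open>a\<close>, namely all \<open>x\<close> whose product with \<open>a\<close> lies in
  \<open>C\<close>, and a largest set of \<open>a\<close> at which this choice belongs to
  \<open>\<B>\<close>. The result is the familiar formula for products of ultrafilters.\<close>

lemma superextension_mult_iff: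
  assumes A: "upfamily (carrier S) \<A>" and B: "upfamily (carrier S) \<B>"
  shows "C \<in> superextension_mult S \<A> \<B> \<longleftrightarrow>
    C \<subseteq> carrier S \<and>
    {a \<in> carrier S. {x \<in> carrier S. a \<otimes>\<^bsub>S\<^esub> x \<in> C} \<in> \<B>} \<in> \<A>"
    (is "_ \<longleftrightarrow> _ \<and> ?D \<in> \<A>")
proof
  assume "C \<in> superextension_mult S \<A> \<B>"
  then obtain A' f where C: "C \<subseteq> carrier S" and A': "A' \<in> \<A>" and f: "f \<in> A' \<rightarrow> \<B>"
    and sub: "(\<Union>a\<in>A'. a <#\<^bsub>S\<^esub> f a) \<subseteq> C"
    by (auto simp: superextension_mult_def generated_upfamily_def)
  \<comment> \<open>Each selected \<open>f a\<close> lies inside the largest choice at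
    \<open>a\<close>, which is therefore in \<open>\<B>\<close> by upward closure.\<close>
  have "A' \<subseteq> ?D"
  proof
    fix a assume a: "a \<in> A'"
    then have fa: "f a \<in> \<B>"
      using f by blast
    then have "f a \<subseteq> carrier S"
      using B by (auto simp: upfamily_def)
    then have "f a \<subseteq> {x \<in> carrier S. a \<otimes>\<^bsub>S\<^esub> x \<in> C}"
      using sub a unfolding l_coset_def by blast
    then have "{x \<in> carrier S. a \<otimes>\<^bsub>S\<^esub> x \<in> C} \<in> \<B>"
      by (rule upfamily_mono[OF B fa]) auto
    then show "a \<in> ?D"
      using a A A' by (auto simp: upfamily_def)
  qed
  then have "?D \<in> \<A>"
    by (rule upfamily_mono[OF A A']) auto
  then show "C \<subseteq> carrier S \<and> ?D \<in> \<A>"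
    using C by blast
next
  assume *: "C \<subseteq> carrier S \<and> ?D \<in> \<A>"
  let ?f = "\<lambda>a. {x \<in> carrier S. a \<otimes>\<^bsub>S\<^esub> x \<in> C}"
  have "(\<Union>a\<in>?D. a <#\<^bsub>S\<^esub> ?f a) \<subseteq> C"
    by (auto simp: l_coset_def)
  moreover have "?f \<in> ?D \<rightarrow> \<B>"
    by blast
  ultimately show "C \<in> superextension_mult S \<A> \<B>"
    using * by (intro superextension_multI[of ?D _ ?f]) auto
qed

lemmas superextension_mult_mem =
  superextension_mult_iff[OF superextension_upfamily superextension_upfamily]

section \<open>The superextension of a group: closure, identity and units\<close>

context group
begin

text \<open>Upward closure and linkedness pass through the membership formula, first for
  \<open>\<B>\<close>, then for \<open>\<A>\<close>. For maximality,
  \<open>superextension_meets\<close> is used once for each factor: a failure would produce a member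
  of the product disjoint from \<open>C\<close>.\<close>

lemma superextension_mult_closed:
  assumes A: "\<A> \<in> superextension (carrier G)" and B: "\<B> \<in> superextension (carrier G)"
  shows "superextension_mult G \<A> \<B> \<in> superextension (carrier G)"
proof -
  \<comment> \<open>For \<open>a\<close> in the group and \<open>C\<close> inside it,
    \<open>?div C a\<close> is the translate of \<open>C\<close> by the inverse of
    \<open>a\<close>.\<close>
  let ?div = "\<lambda>C a. {x \<in> carrier G. a \<otimes> x \<in> C}"
  let ?D = "\<lambda>C. {a \<in> carrier G. ?div C a \<in> \<B>}"
  note mem = superextension_mult_mem[OF A B]
  note upA = superextension_upfamily[OF A] and upB = superextension_upfamily[OF B]
  have ne: "carrier G \<noteq> {}"
    by blast
  show ?thesis
  proof (rule superextensionI)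
    have "upfamily (carrier G) (superextension_mult G \<A> \<B>)"
      unfolding upfamily_def
    proof (intro conjI ballI allI impI)
      show "superextension_mult G \<A> \<B> \<subseteq> Pow (carrier G)"
        using mem by blast
      show "{} \<notin> superextension_mult G \<A> \<B>"
        using upA upB unfolding mem upfamily_def by simp
      fix C C' assume C: "C \<in> superextension_mult G \<A> \<B>" and C': "C \<subseteq> C' \<and> C' \<subseteq> carrier G"
      have "?D C \<subseteq> ?D C'"
      proof
        fix a assume a: "a \<in> ?D C"
        have "?div C' a \<in> \<B>"
          by (rule upfamily_mono[OF upB, of "?div C a"]) (use a C' in auto)
        then show "a \<in> ?D C'"
          using a by simp
      qed
      moreover have "?D C \<in> \<A>"
        using C unfolding mem by simp
      ultimately have "?D C' \<in> \<A>"
        using upfamily_mono[OF upA] by blast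
      then show "C' \<in> superextension_mult G \<A> \<B>"
        using C' unfolding mem by simp
    qed
    moreover have "C \<inter> C' \<noteq> {}"
      if C: "C \<in> superextension_mult G \<A> \<B>" and C': "C' \<in> superextension_mult G \<A> \<B>" for C C'
    proof -
      have "?D C \<inter> ?D C' \<noteq> {}"
        using C C' superextension_linked[OF A] unfolding mem by blast
      then obtain a where "?div C a \<in> \<B>" "?div C' a \<in> \<B>"
        by blast
      then have "?div C a \<inter> ?div C' a \<noteq> {}"
        by (rule superextension_linked[OF B])
      then show ?thesis
        by blast
    qed
    ultimately show "linked_upfamily (carrier G) (superextension_mult G \<A> \<B>)"
      by (simp add: linked_upfamily_def)
  next
    fix C assume C: "C \<subseteq> carrier G"
      and meets: "\<And>E. E \<in> superextension_mult G \<A> \<B> \<Longrightarrow> E \<inter> C \<noteq> {}"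
    have "?D C \<in> \<A>"
    proof (rule superextension_meets[OF A ne])
      fix A' assume A': "A' \<in> \<A>"
      show "A' \<inter> ?D C \<noteq> {}"
      proof
        assume disj: "A' \<inter> ?D C = {}"
        have "A' \<subseteq> carrier G"
          using A' by (rule superextension_subset[OF A])
        \<comment> \<open>As \<open>a\<close> lies outside \<open>?D C\<close>, its quotient
          \<open>?div C a\<close> is not in \<open>\<B>\<close>, so by maximality some member of
          \<open>\<B>\<close> misses it. These witnesses form the selection \<open>f\<close>, whose
          product set avoids \<open>C\<close>.\<close>
        have "\<exists>B'\<in>\<B>. B' \<inter> ?div C a = {}" if "a \<in> A'" for a
        proof (rule ccontr)
          assume "\<not> (\<exists>B'\<in>\<B>. B' \<inter> ?div C a = {})"
          then have "?div C a \<in> \<B>"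
            by (intro superextension_meets[OF B ne]) auto
          then show False
            using disj that \<open>A' \<subseteq> carrier G\<close> by blast
        qed
        then obtain f where f: "f a \<in> \<B>" "f a \<inter> ?div C a = {}" if "a \<in> A'" for a
          by metis
        have sub: "f a \<subseteq> carrier G" if "a \<in> A'" for a
          using f(1)[OF that] by (rule superextension_subset[OF B])
        have "(\<Union>a\<in>A'. a <# f a) \<subseteq> carrier G"
          using \<open>A' \<subseteq> carrier G\<close> sub unfolding l_coset_def by blast
        moreover have "f \<in> A' \<rightarrow> \<B>"
          using f(1) by blast
        ultimately have "(\<Union>a\<in>A'. a <# f a) \<in> superextension_mult G \<A> \<B>"
          using A' by (intro superextension_multI[of A' _ f]) auto
        from meets[OF this] obtain a x where "a \<in> A'" "x \<in> f a" "a \<otimes> x \<in> C"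
          by (auto simp: l_coset_def)
        then show False
          using f(2) sub by blast
      qed
    qed auto
    then show "C \<in> superextension_mult G \<A> \<B>"
      using C unfolding mem by simp
  qed
qed

text \<open>Together with \<open>principal_eq_iff\<close>, this embeds the group into its
  superextension.\<close>

lemma superextension_mult_principal:
  assumes "a \<in> carrier G" "b \<in> carrier G"
  shows "superextension_mult G (principal (carrier G) a) (principal (carrier G) b) =
    principal (carrier G) (a \<otimes> b)"
  using assms
  by (auto simp: superextension_mult_mem principal_in_superextension)
    (auto simp: principal_def)

lemma superextension_mult_one_left:
  assumes "L \<in> superextension (carrier G)"
  shows "superextension_mult G (principal (carrier G) \<one>) L = L"
proof -
  have "{x \<in> carrier G. \<one> \<otimes> x \<in> C} = C" if "C \<subseteq> carrier G" for C
    using that by auto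
  then show ?thesis
    using assms superextension_subset[OF assms]
    by (auto simp: superextension_mult_mem principal_in_superextension)
      (auto simp: principal_def)
qed

lemma superextension_mult_one_right:
  assumes "L \<in> superextension (carrier G)"
  shows "superextension_mult G L (principal (carrier G) \<one>) = L"
proof -
  have "{a \<in> carrier G. {x \<in> carrier G. a \<otimes> x \<in> C} \<in> principal (carrier G) \<one>} = C"
    if "C \<subseteq> carrier G" for C
    using that by (auto simp: principal_def)
  then show ?thesis
    using assms superextension_subset[OF assms]
    by (auto simp: superextension_mult_mem principal_in_superextension)
qed

lemma superextension_unit_principal:
  assumes A: "\<A> \<in> superextension (carrier G)" and B: "\<B> \<in> superextension (carrier G)"
    and unit: "superextension_mult G \<A> \<B> = principal (carrier G) \<one>"
  obtains a where "a \<in> carrier G" "\<A> = principal (carrier G) a"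
proof -
  let ?D = "{a \<in> carrier G. {x \<in> carrier G. a \<otimes> x \<in> {\<one>}} \<in> \<B>}"
  have "{\<one>} \<in> superextension_mult G \<A> \<B>"
    unfolding unit by (simp add: principal_def)
  then have D: "?D \<in> \<A>"
    by (simp add: superextension_mult_mem[OF A B])
  \<comment> \<open>Linkedness of \<open>?D\<close> with itself is nonemptiness.\<close>
  then have "?D \<noteq> {}"
    using superextension_linked[OF A D D] by blast
  then obtain a where a: "a \<in> ?D"
    by blast
  have "b = a" if b: "b \<in> ?D" for b
  proof -
    have "{x \<in> carrier G. a \<otimes> x \<in> {\<one>}} \<inter> {x \<in> carrier G. b \<otimes> x \<in> {\<one>}} \<noteq> {}"
      using superextension_linked[OF B] a b by blast
    then obtain x where "x \<in> carrier G" "a \<otimes> x = \<one>" "b \<otimes> x = \<one>"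
      by blast
    then show ?thesis
      using a b by (metis (no_types, lifting) mem_Collect_eq right_cancel)
  qed
  then have "?D = {a}"
    using a by blast
  then have "\<A> = principal (carrier G) a"
    using superextension_eq_principal[OF A] D by simp
  then show thesis
    using a that by blast
qed

end

section \<open>Isomorphisms of groups and of their superextensions\<close>

lemma superextension_semigroup_simps [simp]:
  "carrier (superextension_semigroup S) = superextension (carrier S)"
  "mult (superextension_semigroup S) = superextension_mult S"
  by (simp_all add: superextension_semigroup_def)

text \<open>Since \<open>f\<close> is multiplicative, dividing by \<open>a\<close> and then taking
  preimages under \<open>f\<close> matches dividing by \<open>f a\<close> first. So the inner and
  the outer set in the membership formula are both preimages of their counterparts in
  \<open>H\<close>.\<close>

lemma pushforward_iso:
  assumes "group G" and f: "f \<in> iso G H"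
  shows "pushforward f (carrier G) (carrier H) \<in>
    iso (superextension_semigroup G) (superextension_semigroup H)"
proof (rule isoI)
  interpret group G by fact
  let ?P = "pushforward f (carrier G) (carrier H)"
  have bij: "bij_betw f (carrier G) (carrier H)"
    using f by (simp add: iso_def)
  have f_hom: "f (a \<otimes>\<^bsub>G\<^esub> b) = f a \<otimes>\<^bsub>H\<^esub> f b" if "a \<in> carrier G" "b \<in> carrier G" for a b
    using f that by (simp add: iso_def hom_def)
  have f_in: "f a \<in> carrier H" if "a \<in> carrier G" for a
    using bij that by (rule bij_betwE[rule_format])
  have ne: "carrier G \<noteq> {}"
    by blast
  note P_in = pushforward_in_superextension[OF bij ne]
  show "bij_betw ?P (carrier (superextension_semigroup G)) (carrier (superextension_semigroup H))"
    using bij_betw_pushforward[OF bij ne] by simp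
  show "?P \<in> hom (superextension_semigroup G) (superextension_semigroup H)"
  proof (rule homI)
    fix \<A> \<B>
    assume "\<A> \<in> carrier (superextension_semigroup G)" "\<B> \<in> carrier (superextension_semigroup G)"
    then have A: "\<A> \<in> superextension (carrier G)" and B: "\<B> \<in> superextension (carrier G)"
      by simp_all
    have "D \<in> ?P (superextension_mult G \<A> \<B>) \<longleftrightarrow> D \<in> superextension_mult H (?P \<A>) (?P \<B>)"
      for D
    proof -
      have 1: "{x \<in> carrier G. a \<otimes>\<^bsub>G\<^esub> x \<in> {z \<in> carrier G. f z \<in> D}} =
          {x \<in> carrier G. f x \<in> {y \<in> carrier H. f a \<otimes>\<^bsub>H\<^esub> y \<in> D}}"
        if "a \<in> carrier G" for a
        using that f_hom f_in by auto
      have 2: "{a \<in> carrier G. {x \<in> carrier G. a \<otimes>\<^bsub>G\<^esub> x \<in> {z \<in> carrier G. f z \<in> D}} \<in> \<B>} =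
          {a \<in> carrier G. f a \<in> {b \<in> carrier H. {y \<in> carrier H. b \<otimes>\<^bsub>H\<^esub> y \<in> D} \<in> ?P \<B>}}"
        using 1 f_in by (auto simp: pushforward_def)
      have "D \<in> ?P (superextension_mult G \<A> \<B>) \<longleftrightarrow> D \<subseteq> carrier H \<and>
          {a \<in> carrier G. {x \<in> carrier G. a \<otimes>\<^bsub>G\<^esub> x \<in> {z \<in> carrier G. f z \<in> D}} \<in> \<B>} \<in> \<A>"
        unfolding pushforward_def mem_Collect_eq[of D] superextension_mult_mem[OF A B] by auto
      also have "\<dots> \<longleftrightarrow> D \<in> superextension_mult H (?P \<A>) (?P \<B>)"
        \<comment> \<open>Only the outer \<open>pushforward\<close>, at \<open>\<A>\<close>, is
          expanded; \<open>?P \<B>\<close> keeps the form it has in \<open>2\<close>.\<close>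
        unfolding superextension_mult_mem[OF P_in[OF A] P_in[OF B]] 2
        by (auto simp: pushforward_def[of _ _ _ \<A>])
      finally show ?thesis .
    qed
    then show "?P (\<A> \<otimes>\<^bsub>superextension_semigroup G\<^esub> \<B>) =
        ?P \<A> \<otimes>\<^bsub>superextension_semigroup H\<^esub> ?P \<B>"
      by auto
  qed (use P_in in simp)
qed

text \<open>Once \<open>\<phi>\<close> is known to preserve the identity, the images of the
  principal ultrafilters at \<open>a\<close> and at its inverse multiply to the identity, so
  \<open>superextension_unit_principal\<close> applies.\<close>

lemma superextension_iso_principal:
  assumes "group G" "group H"
    and \<phi>: "\<phi> \<in> iso (superextension_semigroup G) (superextension_semigroup H)"
    and a: "a \<in> carrier G"
  obtains b where "b \<in> carrier H" "\<phi> (principal (carrier G) a) = principal (carrier H) b"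
proof -
  interpret G: group G by fact
  interpret H: group H by fact
  let ?p = "principal (carrier G)" and ?q = "principal (carrier H)"
  have bij: "bij_betw \<phi> (superextension (carrier G)) (superextension (carrier H))"
    using \<phi> by (simp add: iso_def)
  have hom: "\<phi> (superextension_mult G K L) = superextension_mult H (\<phi> K) (\<phi> L)"
    if "K \<in> superextension (carrier G)" "L \<in> superextension (carrier G)" for K L
    using \<phi> that by (simp add: iso_def hom_def)
  have \<phi>_in: "\<phi> L \<in> superextension (carrier H)" if "L \<in> superextension (carrier G)" for L
    using bij that by (rule bij_betwE[rule_format])
  note p_in = principal_in_superextension[where X = "carrier G"]
  have "?q \<one>\<^bsub>H\<^esub> \<in> superextension (carrier H)"
    by (simp add: principal_in_superextension)
  \<comment> \<open>Membership in \<open>iso\<close> says nothing about units. Surjectivity supplies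
    a preimage \<open>L\<close> of the identity, and computing the image of \<open>?p \<one>\<close>
    times \<open>L\<close> in two ways identifies the image of \<open>?p \<one>\<close>.\<close>
  then obtain L where L: "L \<in> superextension (carrier G)" "\<phi> L = ?q \<one>\<^bsub>H\<^esub>"
    using bij by (metis bij_betw_def imageE)
  have "\<phi> (?p \<one>\<^bsub>G\<^esub>) = superextension_mult H (\<phi> (?p \<one>\<^bsub>G\<^esub>)) (?q \<one>\<^bsub>H\<^esub>)"
    by (simp add: H.superextension_mult_one_right \<phi>_in p_in)
  also have "\<dots> = \<phi> (superextension_mult G (?p \<one>\<^bsub>G\<^esub>) L)"
    by (simp add: hom L p_in)
  also have "\<dots> = ?q \<one>\<^bsub>H\<^esub>"
    by (simp add: G.superextension_mult_one_left L)
  finally have one: "\<phi> (?p \<one>\<^bsub>G\<^esub>) = ?q \<one>\<^bsub>H\<^esub>" .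
  have "superextension_mult H (\<phi> (?p a)) (\<phi> (?p (inv\<^bsub>G\<^esub> a))) = ?q \<one>\<^bsub>H\<^esub>"
    using a by (simp add: hom[symmetric] p_in G.superextension_mult_principal one)
  then show thesis
    using H.superextension_unit_principal[of "\<phi> (?p a)" "\<phi> (?p (inv\<^bsub>G\<^esub> a))"] that \<phi>_in p_in a
    by auto
qed

text \<open>Provides the inverse isomorphism, through which surjectivity on principal ultrafilters
  is obtained below.\<close>

lemma superextension_semigroup_iso_sym:
  assumes "group G"
    and \<phi>: "\<phi> \<in> iso (superextension_semigroup G) (superextension_semigroup H)"
  shows "inv_into (superextension (carrier G)) \<phi> \<in>
    iso (superextension_semigroup H) (superextension_semigroup G)"
proof (rule isoI)
  let ?X = "superextension (carrier G)" and ?Y = "superextension (carrier H)"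
  let ?\<psi> = "inv_into ?X \<phi>"
  have bij: "bij_betw \<phi> ?X ?Y"
    using \<phi> by (simp add: iso_def)
  have hom: "\<phi> (superextension_mult G K L) = superextension_mult H (\<phi> K) (\<phi> L)"
    if "K \<in> ?X" "L \<in> ?X" for K L
    using \<phi> that by (simp add: iso_def hom_def)
  have \<psi>: "bij_betw ?\<psi> ?Y ?X"
    using bij by (rule bij_betw_inv_into)
  then show "bij_betw ?\<psi> (carrier (superextension_semigroup H)) (carrier (superextension_semigroup G))"
    by simp
  have \<psi>_in: "?\<psi> L \<in> ?X" if "L \<in> ?Y" for L
    using \<psi> that by (rule bij_betwE[rule_format])
  show "?\<psi> \<in> hom (superextension_semigroup H) (superextension_semigroup G)"
  proof (rule homI)
    fix K L
    assume "K \<in> carrier (superextension_semigroup H)" "L \<in> carrier (superextension_semigroup H)"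
    then have KL: "K \<in> ?Y" "L \<in> ?Y"
      by simp_all
    then have "superextension_mult H K L = \<phi> (superextension_mult G (?\<psi> K) (?\<psi> L))"
      using hom \<psi>_in bij_betw_inv_into_right[OF bij] by simp
    \<comment> \<open>\<open>?\<psi>\<close> undoes \<open>\<phi>\<close> only on \<open>?X\<close>,
      so the product has to stay there.\<close>
    moreover have "superextension_mult G (?\<psi> K) (?\<psi> L) \<in> ?X"
      using group.superextension_mult_closed[OF \<open>group G\<close>] \<psi>_in KL by blast
    ultimately show "?\<psi> (K \<otimes>\<^bsub>superextension_semigroup H\<^esub> L) =
        ?\<psi> K \<otimes>\<^bsub>superextension_semigroup G\<^esub> ?\<psi> L"
      using bij_betw_inv_into_left[OF bij] by simp
  qed (use \<psi>_in in simp)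
qed

text \<open>The restriction of \<open>\<phi>\<close> to principal ultrafilters, read through the
  embeddings of both groups, is the required map \<open>f\<close>.\<close>

lemma group_iso_if_superextension_iso:
  assumes "group G" "group H"
    and \<phi>: "\<phi> \<in> iso (superextension_semigroup G) (superextension_semigroup H)"
  shows "G \<cong> H"
proof -
  interpret G: group G by fact
  interpret H: group H by fact
  let ?p = "principal (carrier G)" and ?q = "principal (carrier H)"
  let ?X = "superextension (carrier G)"
  have bij: "bij_betw \<phi> ?X (superextension (carrier H))"
    using \<phi> by (simp add: iso_def)
  have hom: "\<phi> (superextension_mult G K L) = superextension_mult H (\<phi> K) (\<phi> L)"
    if "K \<in> ?X" "L \<in> ?X" for K L
    using \<phi> that by (simp add: iso_def hom_def)
  note p_in = principal_in_superextension[where X = "carrier G"]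
    and q_in = principal_in_superextension[where X = "carrier H"]
  have "\<exists>b\<in>carrier H. \<phi> (?p a) = ?q b" if "a \<in> carrier G" for a
    using superextension_iso_principal[OF assms that] by blast
  then obtain f where f: "f a \<in> carrier H" "\<phi> (?p a) = ?q (f a)" if "a \<in> carrier G" for a
    by metis
  have "f (a \<otimes>\<^bsub>G\<^esub> b) = f a \<otimes>\<^bsub>H\<^esub> f b" if ab: "a \<in> carrier G" "b \<in> carrier G" for a b
  proof -
    have "?q (f (a \<otimes>\<^bsub>G\<^esub> b)) = \<phi> (superextension_mult G (?p a) (?p b))"
      using ab by (simp add: f(2) G.superextension_mult_principal)
    also have "\<dots> = ?q (f a \<otimes>\<^bsub>H\<^esub> f b)"
      using ab by (simp add: hom p_in f H.superextension_mult_principal)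
    finally show ?thesis
      using ab f(1) by (simp add: principal_eq_iff)
  qed
  then have "f \<in> hom G H"
    using f(1) by (intro homI) auto
  moreover have "inj_on f (carrier G)"
  proof (rule inj_onI)
    fix a b assume ab: "a \<in> carrier G" "b \<in> carrier G" "f a = f b"
    then have "\<phi> (?p a) = \<phi> (?p b)"
      by (simp add: f(2))
    then have "?p a = ?p b"
      using bij ab p_in by (meson bij_betw_def inj_onD)
    then show "a = b"
      using ab by (simp add: principal_eq_iff)
  qed
  \<comment> \<open>The inverse of \<open>\<phi>\<close> also sends principal ultrafilters to
    principal ones; the point belonging to the image of \<open>?q b\<close> is the preimage of
    \<open>b\<close>.\<close>
  moreover have "b \<in> f ` carrier G" if b: "b \<in> carrier H" for b
  proof -
    obtain a where a: "a \<in> carrier G" "inv_into ?X \<phi> (?q b) = ?p a"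
      using superextension_iso_principal[OF \<open>group H\<close> \<open>group G\<close>
          superextension_semigroup_iso_sym[OF \<open>group G\<close> \<phi>] b] by blast
    then have "?q b = ?q (f a)"
      using bij_betw_inv_into_right[OF bij q_in[OF b]] f(2) by simp
    then have "b = f a"
      using a b f(1) by (simp add: principal_eq_iff)
    then show ?thesis
      using a by blast
  qed
  ultimately have "f \<in> iso G H"
    using f(1) by (auto simp: iso_def bij_betw_def)
  then show ?thesis
    by (auto simp: is_iso_def)
qed

theorem theorem1p7:
  fixes G :: "('a, 'm) monoid_scheme" and H :: "('b, 'n) monoid_scheme"
  assumes "group G" and "group H"
  shows "G \<cong> H \<longleftrightarrow> superextension_semigroup G \<cong> superextension_semigroup H"
proof
  assume "G \<cong> H"
  then show "superextension_semigroup G \<cong> superextension_semigroup H"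
    using pushforward_iso[OF \<open>group G\<close>] by (auto simp: is_iso_def)
next
  assume "superextension_semigroup G \<cong> superextension_semigroup H"
  then show "G \<cong> H"
    using group_iso_if_superextension_iso[OF assms] by (auto simp: is_iso_def)
qed

end
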